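(* Let $A$ be a bounded maximally hyperfractal subset of $\mathbb{R}^N$ and let $m\in\mathbb{N}$ be a positive integer. Then the "fractal grill" $A\times[0,1]^m\subset\mathbb{R}^{N+m}$ is also maximally hyperfractal.
   Context: For a bounded nonempty set $B\subset\mathbb{R}^M$ ($M\ge1$), let $B_\delta=\{x\in\mathbb{R}^M:d(x,B)<\delta\}$, where $d$ is Euclidean distance. For a fixed $\delta>0$, the distance zeta function of $B$ is $\zeta_B(s)=\int_{B_\delta}d(x,B)^{s-M}dx$ for $\operatorname{Re}s$ sufficiently large (changing $\delta$ adds an entire function). Its abscissa of convergence is $D(\zeta_B)=\inf\{\sigma\ge0:\int_{B_\delta}d(x,B)^{\sigma-M}dx<\infty\}$, which is known to equal the upper Minkowski dimension of $B$, and $\{\operatorname{Re}s=D(\zeta_B)\}$ is the critical line. A point $s_0$ of the critical line is a nonremovable singularity of $\zeta_B$ if there is no open disk $U$ centered at $s_0$ and holomorphic function on $U$ agreeing with $\zeta_B$ on $U\cap\{\operatorname{Re}s>D(\zeta_B)\}$. The bounded set $B$ is maximally hyperfractal if every point of the critical line is a nonremovable singularity of $\zeta_B$. *)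

theory Defs
  imports "HOL-Analysis.Analysis"
begin

definition tube :: "real \<Rightarrow> 'a::euclidean_space set \<Rightarrow> 'a set" where
  "tube \<delta> B = {x. infdist x B < \<delta>}"

text \<open>
  Real powers of distances with the measure-theoretic convention that a negative power
  of 0 is infinite. The library convention \<open>0 powr a = 0\<close> would ignore the closure
  of \<open>B\<close> in the abscissa below and give a wrong value when that closure has positive
  measure. (The value of \<open>0\<close> to the power \<open>0\<close>, which is \<open>0\<close> here, is immaterial,
  since a tube around a bounded set has finite measure.)
\<close>

definition ext_powr :: "real \<Rightarrow> real \<Rightarrow> ennreal" where
  "ext_powr t a = (if t = 0 \<and> a < 0 then \<infinity> else ennreal (t powr a))"

definition abscissa :: "real \<Rightarrow> 'a::euclidean_space set \<Rightarrow> real" where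
  "abscissa \<delta> B =
     Inf {\<sigma>. 0 \<le> \<sigma> \<and>
       (\<integral>\<^sup>+x\<in>tube \<delta> B. ext_powr (infdist x B) (\<sigma> - real DIM('a)) \<partial>lborel) < \<infinity>}"

text \<open>
  The following is meaningful for \<open>Re s > abscissa \<delta> B\<close>, where the integral converges
  absolutely. There \<open>0 powr z = 0\<close> does no harm: if the closure of \<open>B\<close> has
  positive measure, then \<open>abscissa \<delta> B = DIM('a)\<close>, so the exponent has positive real part.
\<close>

definition distance_zeta :: "real \<Rightarrow> 'a::euclidean_space set \<Rightarrow> complex \<Rightarrow> complex" where
  "distance_zeta \<delta> B s =
     (LINT x:tube \<delta> B|lborel. complex_of_real (infdist x B) powr (s - of_nat DIM('a)))"

definition nonremovable_singularity ::
    "real \<Rightarrow> 'a::euclidean_space set \<Rightarrow> complex \<Rightarrow> bool" where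
  "nonremovable_singularity \<delta> B s\<^sub>0 \<longleftrightarrow>
     \<not> (\<exists>r>0. \<exists>g. g holomorphic_on ball s\<^sub>0 r \<and>
          (\<forall>s \<in> ball s\<^sub>0 r. Re s > abscissa \<delta> B \<longrightarrow> g s = distance_zeta \<delta> B s))"

definition maximally_hyperfractal :: "real \<Rightarrow> 'a::euclidean_space set \<Rightarrow> bool" where
  "maximally_hyperfractal \<delta> B \<longleftrightarrow>
     bounded B \<and> B \<noteq> {} \<and>
     (\<forall>s\<^sub>0. Re s\<^sub>0 = abscissa \<delta> B \<longrightarrow> nonremovable_singularity \<delta> B s\<^sub>0)"

end

theory Submission
  imports Defs "HOL-Complex_Analysis.Complex_Analysis"
begin

text \<open>
  The distance from \<open>(x, y)\<close> to \<open>A \<times> Q\<close>, \<open>Q\<close> the unit cube, is \<open>sqrt (d\<^sup>2 + \<rho>\<^sup>2)\<close> with \<open>d\<close> the distance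
  of \<open>x\<close> to \<open>A\<close> and \<open>\<rho>\<close> that of \<open>y\<close> to \<open>Q\<close>. The part \<open>y \<in> Q\<close> of the zeta integral of \<open>A \<times> Q\<close> at \<open>s\<close>
  is exactly the zeta function of \<open>A\<close> at \<open>s - m\<close>. On the part \<open>y \<notin> Q\<close> the integrand is at most
  \<open>d powr (-b) * \<rho> powr (-c)\<close> in modulus, where \<open>b + c = N + m - Re s\<close>; as \<open>\<rho> powr (-c)\<close> is integrable for
  \<open>c < 1\<close>, this part converges, and is holomorphic, up to distance \<open>1\<close> to the left of the critical line.
  So the zeta functions of \<open>A \<times> Q\<close> at \<open>s\<close> and of \<open>A\<close> at \<open>s - m\<close> have the same singularities on their
  critical lines, which correspond under the shift by \<open>m\<close>.
\<close>

subsection \<open>Holomorphic dependence on the exponent\<close>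

text \<open>
  Around \<open>z0\<close>, expand \<open>f powr z = f powr z0 * exp ((z - z0) * ln f)\<close> in powers of \<open>z - z0\<close> and integrate
  termwise; \<open>f powr (Re z0 - r) + f powr (Re z0 + r)\<close> dominates the series for \<open>\<bar>z - z0\<bar> < r\<close>.
\<close>

lemma integral_powr_holomorphic:
  fixes f :: "'a \<Rightarrow> real"
  assumes f [measurable]: "f \<in> borel_measurable M" and nonneg: "\<And>x. 0 \<le> f x"
    and int: "\<And>\<sigma>. a < \<sigma> \<Longrightarrow> integrable M (\<lambda>x. f x powr \<sigma>)"
  shows "(\<lambda>z. \<integral>x. complex_of_real (f x) powr z \<partial>M) holomorphic_on {z. a < Re z}"
proof -
  have "(\<lambda>z. \<integral>x. complex_of_real (f x) powr z \<partial>M) holomorphic_on ball z0 ((Re z0 - a) / 2)"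
    if z0: "a < Re z0" for z0
  proof (rule power_series_holomorphic)
    \<comment> \<open>Half the distance from \<open>z0\<close> to the boundary line, so that the
      dominating exponents \<open>Re z0 - r\<close> and \<open>Re z0 + r\<close> both stay above
      \<open>a\<close>.\<close>
    define r where "r = (Re z0 - a) / 2"
    define H where "H x = f x powr (Re z0 - r) + f x powr (Re z0 + r)" for x
    have "0 < r" and "a < Re z0 - r" using z0 by (auto simp: r_def field_simps)
    then have H: "integrable M H" unfolding H_def by (intro Bochner_Integration.integrable_add int) auto
    fix w assume "w \<in> ball z0 ((Re z0 - a) / 2)"
    then have w: "norm (w - z0) < r" by (simp add: r_def dist_norm norm_minus_commute)
    define F where "F n x = complex_of_real (f x) powr z0 * complex_of_real (ln (f x)) ^ n / fact n * (w - z0) ^ n" for n x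
    define G where "G n x = (\<bar>ln (f x)\<bar> * norm (w - z0)) ^ n /\<^sub>R fact n" for n x
    have normF: "norm (F n x) = f x powr Re z0 * G n x" for n x
      using nonneg[of x] by (simp add: F_def G_def norm_mult norm_divide norm_power norm_powr_real_powr field_simps)
    have Gsums: "(\<lambda>n. G n x) sums exp (\<bar>ln (f x)\<bar> * norm (w - z0))" for x
      unfolding G_def by (rule exp_converges)
    have expH: "f x powr Re z0 * exp (\<bar>ln (f x)\<bar> * norm (w - z0)) \<le> H x" for x
    proof (cases "f x = 0")
      case False
      then have pos: "0 < f x" using nonneg[of x] by simp
      have "exp (\<bar>ln (f x)\<bar> * norm (w - z0)) \<le> exp (\<bar>ln (f x)\<bar> * r)"
        using w by (simp add: mult_left_mono)
      \<comment> \<open>The left side equals \<open>f x powr r\<close> or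
        \<open>f x powr (- r)\<close>, according to the sign of \<open>ln (f x)\<close>; the sum
        covers both cases.\<close>
      also have "\<dots> \<le> f x powr (- r) + f x powr r"
        using pos \<open>0 < r\<close> by (auto simp: powr_def abs_if mult.commute)
      finally have "f x powr Re z0 * exp (\<bar>ln (f x)\<bar> * norm (w - z0)) \<le> f x powr Re z0 * (f x powr (- r) + f x powr r)"
        by (intro mult_left_mono) auto
      also have "\<dots> = H x" by (simp add: H_def ring_distribs flip: powr_add)
      finally show ?thesis .
    qed (simp add: H_def)
    have sumF: "(\<Sum>n<k. norm (F n x)) \<le> H x" for k x
    proof -
      have "(\<Sum>n<k. norm (F n x)) = f x powr Re z0 * (\<Sum>n<k. G n x)"
        by (simp add: normF sum_distrib_left)
      also have "\<dots> \<le> f x powr Re z0 * exp (\<bar>ln (f x)\<bar> * norm (w - z0))"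
      proof (rule mult_left_mono)
        have "(\<Sum>n<k. G n x) \<le> (\<Sum>n. G n x)"
          using Gsums[of x] by (intro sum_le_suminf) (auto simp: sums_iff G_def)
        then show "(\<Sum>n<k. G n x) \<le> exp (\<bar>ln (f x)\<bar> * norm (w - z0))"
          using Gsums[of x] by (simp add: sums_iff)
      qed simp
      finally show ?thesis using expH[of x] by simp
    qed
    have Fint: "integrable M (F n)" for n
    proof (rule Bochner_Integration.integrable_bound[OF H])
      show "F n \<in> borel_measurable M" unfolding F_def by measurable
      show "AE x in M. norm (F n x) \<le> norm (H x)"
      proof (rule AE_I2)
        fix x
        have "norm (F n x) \<le> (\<Sum>k<Suc n. norm (F k x))" by (rule member_le_sum) auto
        then show "norm (F n x) \<le> norm (H x)" using sumF[of x "Suc n"] by simp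
      qed
    qed
    have "(\<lambda>n. integral\<^sup>L M (F n)) sums (\<integral>x. (\<Sum>n. F n x) \<partial>M)"
    proof (rule sums_integral[OF Fint])
      show "AE x in M. summable (\<lambda>n. norm (F n x))"
        unfolding normF using Gsums by (intro AE_I2 summable_mult) (auto simp: sums_iff)
      show "summable (\<lambda>n. \<integral>x. norm (F n x) \<partial>M)"
      proof (rule summableI_nonneg_bounded)
        fix k
        have "(\<Sum>n<k. \<integral>x. norm (F n x) \<partial>M) = (\<integral>x. (\<Sum>n<k. norm (F n x)) \<partial>M)"
          using Fint by (subst Bochner_Integration.integral_sum) auto
        also have "\<dots> \<le> integral\<^sup>L M H"
          using Fint H sumF by (intro integral_mono) auto
        finally show "(\<Sum>n<k. \<integral>x. norm (F n x) \<partial>M) \<le> integral\<^sup>L M H" .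
      qed auto
    qed
    \<comment> \<open>Where \<open>f x = 0\<close>, the convention \<open>0 powr z = 0\<close> makes
      every term and the limit vanish.\<close>
    moreover have "(\<Sum>n. F n x) = complex_of_real (f x) powr w" for x
    proof (cases "f x = 0")
      case False
      then have pos: "0 < f x" using nonneg[of x] by simp
      have "(\<lambda>n. complex_of_real (f x) powr z0 * ((complex_of_real (ln (f x)) * (w - z0)) ^ n /\<^sub>R fact n)) sums
            (complex_of_real (f x) powr z0 * exp (complex_of_real (ln (f x)) * (w - z0)))"
        by (intro sums_mult exp_converges)
      moreover have "(\<lambda>n. complex_of_real (f x) powr z0 * ((complex_of_real (ln (f x)) * (w - z0)) ^ n /\<^sub>R fact n)) = (\<lambda>n. F n x)"
        by (simp add: F_def fun_eq_iff scaleR_conv_of_real power_mult_distrib divide_inverse mult_ac)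
      moreover have "complex_of_real (f x) powr z0 * exp (complex_of_real (ln (f x)) * (w - z0)) = complex_of_real (f x) powr w"
        using pos by (simp add: powr_def Ln_of_real algebra_simps flip: exp_add)
      ultimately show ?thesis by (metis sums_unique)
    qed (simp add: F_def)
    moreover have "integral\<^sup>L M (F n) = (\<integral>x. complex_of_real (f x) powr z0 * complex_of_real (ln (f x)) ^ n / fact n \<partial>M) * (w - z0) ^ n" for n
      by (simp add: F_def[abs_def])
    ultimately show "(\<lambda>n. (\<integral>x. complex_of_real (f x) powr z0 * complex_of_real (ln (f x)) ^ n / fact n \<partial>M) * (w - z0) ^ n) sums
        (\<integral>x. complex_of_real (f x) powr w \<partial>M)" by simp
  qed
  then have "(\<lambda>z. \<integral>x. complex_of_real (f x) powr z \<partial>M) holomorphic_on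
      (\<Union>z0\<in>{z. a < Re z}. ball z0 ((Re z0 - a) / 2))"
    by (intro holomorphic_on_UN_open) auto
  then show ?thesis by (rule holomorphic_on_subset) force
qed

subsection \<open>Integrals of powers of the distance\<close>

text \<open>The parameter is the bare exponent, not the \<open>\<sigma>\<close> of
  \<open>abscissa\<close> from which the dimension is subtracted, so that sets in spaces of
  different dimensions can be compared at the same power of the distance.\<close>

definition dist_integral :: "real \<Rightarrow> 'a::euclidean_space set \<Rightarrow> real \<Rightarrow> ennreal" where
  "dist_integral \<delta> A \<tau> = (\<integral>\<^sup>+x\<in>tube \<delta> A. ext_powr (infdist x A) \<tau> \<partial>lborel)"

text \<open>Nearest points \<open>a\<close> and \<open>b\<close> exist in the closures, and
  \<open>(a, b)\<close> gives the upper bound. For the lower bound, each component of a point of the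
  product is at least the respective distance away.\<close>

lemma infdist_Times:
  fixes A :: "'a::euclidean_space set" and B :: "'b::euclidean_space set"
  assumes "A \<noteq> {}" "B \<noteq> {}"
  shows "infdist (x, y) (A \<times> B) = sqrt ((infdist x A)\<^sup>2 + (infdist y B)\<^sup>2)"
proof (rule antisym)
  obtain a where a: "a \<in> closure A" "infdist x (closure A) = dist x a"
    using infdist_attains_inf[of "closure A" x] assms by auto
  obtain b where b: "b \<in> closure B" "infdist y (closure B) = dist y b"
    using infdist_attains_inf[of "closure B" y] assms by auto
  have "infdist (x, y) (closure (A \<times> B)) \<le> dist (x, y) (a, b)"
    using a b by (intro infdist_le) (simp add: closure_Times)
  then show "infdist (x, y) (A \<times> B) \<le> sqrt ((infdist x A)\<^sup>2 + (infdist y B)\<^sup>2)"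
    using a(2) b(2) by (simp add: dist_Pair_Pair infdist_eq_setdist)
  show "sqrt ((infdist x A)\<^sup>2 + (infdist y B)\<^sup>2) \<le> infdist (x, y) (A \<times> B)"
  proof -
    have "sqrt ((infdist x A)\<^sup>2 + (infdist y B)\<^sup>2) \<le> dist (x, y) p" if "p \<in> A \<times> B" for p
      using that by (auto simp: dist_Pair_Pair infdist_nonneg intro!: add_mono power_mono infdist_le)
    then show ?thesis using assms unfolding infdist_def[of "(x, y)"]
      by (auto intro!: cINF_greatest)
  qed
qed

lemma ext_powr_measurable [measurable]: "(\<lambda>t. ext_powr t a) \<in> borel_measurable borel"
  unfolding ext_powr_def by measurable

lemma infdist_measurable [measurable]: "(\<lambda>x. infdist x A) \<in> borel_measurable borel"
  by (intro borel_measurable_continuous_onI continuous_intros)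

lemma tube_sets [measurable]: "tube \<delta> A \<in> sets borel"
  unfolding tube_def by measurable

text \<open>The infinite value at \<open>0\<close> is what makes this true for \<open>t = 0\<close>.
  For \<open>a = 0\<close> it would fail there, as \<open>ext_powr 0 0 = 0\<close>.\<close>

lemma ext_powr_antimono: "0 \<le> t \<Longrightarrow> t \<le> u \<Longrightarrow> a < 0 \<Longrightarrow> ext_powr u a \<le> ext_powr t a"
  by (auto simp: ext_powr_def powr_mono2' intro!: ennreal_leI)

lemma ext_powr_le_powr: "0 \<le> t \<Longrightarrow> t \<le> u \<Longrightarrow> 0 \<le> a \<Longrightarrow> ext_powr t a \<le> ennreal (u powr a)"
  by (auto simp: ext_powr_def powr_mono2 intro!: ennreal_leI)

lemma bounded_tube:
  assumes "bounded A" "A \<noteq> {}"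
  shows "bounded (tube \<delta> A)"
proof -
  obtain a R where R: "A \<subseteq> cball a R" using assms bounded_subset_cball by blast
  have "tube \<delta> A \<subseteq> cball a (R + \<delta>)"
  proof
    fix x assume "x \<in> tube \<delta> A"
    then have "\<not> \<delta> \<le> (INF b\<in>A. dist x b)"
      using assms(2) by (simp add: tube_def infdist_def)
    then obtain b where "b \<in> A" "dist x b < \<delta>"
      using cINF_greatest[OF assms(2), of \<delta> "dist x"] by force
    then show "x \<in> cball a (R + \<delta>)"
      using R dist_triangle[of a x b] by (auto simp: dist_commute subset_eq)
  qed
  then show ?thesis using bounded_cball bounded_subset by blast
qed

lemma emeasure_tube_finite:
  "bounded A \<Longrightarrow> A \<noteq> {} \<Longrightarrow> emeasure lborel (tube \<delta> A) < \<infinity>"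
  using bounded_tube emeasure_bounded_finite by blast

lemma dist_integral_nonneg_exponent:
  assumes "bounded A" "A \<noteq> {}" "0 \<le> \<tau>"
  shows "dist_integral \<delta> A \<tau> < \<infinity>"
proof -
  have "dist_integral \<delta> A \<tau> \<le> (\<integral>\<^sup>+x. ennreal (\<delta> powr \<tau>) * indicator (tube \<delta> A) x \<partial>lborel)"
    unfolding dist_integral_def using assms
    by (intro nn_integral_mono) (auto simp: tube_def infdist_nonneg intro!: ext_powr_le_powr split: split_indicator)
  also have "\<dots> < \<infinity>"
    using emeasure_tube_finite[OF assms(1,2), of \<delta>] by (simp add: nn_integral_cmult_indicator ennreal_mult_less_top)
  finally show ?thesis .
qed

text \<open>Away from \<open>A\<close> an exponent of either sign is harmless: a monotone power is
  bounded by the sum of its values at the two ends of the shell. Hence the tube radius affects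
  neither convergence nor singularities.\<close>

lemma dist_integral_shell_finite:
  assumes "bounded A" "A \<noteq> {}" "0 < \<delta>" "0 < \<epsilon>"
  shows "(\<integral>\<^sup>+x\<in>tube \<epsilon> A - tube \<delta> A. ext_powr (infdist x A) \<tau> \<partial>lborel) < \<infinity>"
proof -
  let ?C = "ennreal (\<delta> powr \<tau> + \<epsilon> powr \<tau>)"
  have *: "ext_powr (infdist x A) \<tau> \<le> ?C" if "\<delta> \<le> infdist x A" "infdist x A < \<epsilon>" for x
  proof -
    have "infdist x A powr \<tau> \<le> \<delta> powr \<tau> + \<epsilon> powr \<tau>"
    proof (cases "0 \<le> \<tau>")
      case True
      then have "infdist x A powr \<tau> \<le> \<epsilon> powr \<tau>" using that assms by (intro powr_mono2) auto
      then show ?thesis using powr_ge_zero[of \<delta> \<tau>] by linarith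
    next
      case False
      then have "infdist x A powr \<tau> \<le> \<delta> powr \<tau>" using that assms by (intro powr_mono2') auto
      then show ?thesis using powr_ge_zero[of \<epsilon> \<tau>] by linarith
    qed
    then show ?thesis using that assms by (auto simp: ext_powr_def intro!: ennreal_leI simp del: ennreal_plus)
  qed
  have "(\<integral>\<^sup>+x\<in>tube \<epsilon> A - tube \<delta> A. ext_powr (infdist x A) \<tau> \<partial>lborel)
      \<le> (\<integral>\<^sup>+x. ?C * indicator (tube \<epsilon> A) x \<partial>lborel)"
    using * by (intro nn_integral_mono) (auto simp: tube_def split: split_indicator simp del: ennreal_plus)
  also have "\<dots> < \<infinity>"
    using emeasure_tube_finite[OF assms(1,2), of \<epsilon>]
    by (simp add: nn_integral_cmult_indicator ennreal_mult_less_top del: ennreal_plus)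
  finally show ?thesis .
qed

lemma dist_integral_radius:
  assumes "bounded A" "A \<noteq> {}" "0 < \<delta>" "0 < \<epsilon>" "dist_integral \<delta> A \<tau> < \<infinity>"
  shows "dist_integral \<epsilon> A \<tau> < \<infinity>"
proof -
  let ?f = "\<lambda>x. ext_powr (infdist x A) \<tau>"
  have "dist_integral \<epsilon> A \<tau> \<le> (\<integral>\<^sup>+x. ?f x * indicator (tube \<delta> A) x + ?f x * indicator (tube \<epsilon> A - tube \<delta> A) x \<partial>lborel)"
    unfolding dist_integral_def by (intro nn_integral_mono) (auto split: split_indicator)
  also have "\<dots> = dist_integral \<delta> A \<tau> + (\<integral>\<^sup>+x\<in>tube \<epsilon> A - tube \<delta> A. ?f x \<partial>lborel)"
    by (subst nn_integral_add) (auto simp: dist_integral_def)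
  also have "\<dots> < \<infinity>"
    using dist_integral_shell_finite[OF assms(1-4), of \<tau>] assms(5) by simp
  finally show ?thesis .
qed

text \<open>In terms of \<open>\<sigma> = \<tau> + DIM('a)\<close>, no negative
  \<open>\<sigma>\<close> gives convergence. This reconciles the constraint
  \<open>0 \<le> \<sigma>\<close> in \<open>abscissa\<close> with the shift by the dimension of the
  cube.\<close>

lemma dist_integral_below_neg_dim:
  fixes A :: "'a::euclidean_space set"
  assumes "A \<noteq> {}" "0 < \<delta>" "\<tau> < - real DIM('a)"
  shows "dist_integral \<delta> A \<tau> = \<infinity>"
proof (rule ccontr)
  assume "dist_integral \<delta> A \<tau> \<noteq> \<infinity>"
  then obtain c where c: "0 \<le> c" "dist_integral \<delta> A \<tau> = ennreal c"
    by (cases "dist_integral \<delta> A \<tau>") auto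
  obtain a where a: "a \<in> A" using assms by auto
  \<comment> \<open>The ball of radius \<open>r\<close> around \<open>a\<close> alone contributes at least \<open>v * r powr (\<tau> + n)\<close>, unbounded as \<open>r \<rightarrow> 0\<close>.\<close>
  define n where "n = real DIM('a)"
  define v where "v = unit_ball_vol n"
  have v: "0 < v" by (simp add: v_def n_def)
  have neg: "\<tau> + n < 0" using assms by (simp add: n_def)
  have bound: "v * r powr (\<tau> + n) \<le> c" if r: "0 < r" "r < \<delta>" for r
  proof -
    have dist: "infdist x A \<le> r" if "x \<in> cball a r" for x
      using that infdist_le[OF a, of x] by (simp add: dist_commute)
    have "ennreal (v * r powr (\<tau> + n)) = ennreal (r powr \<tau>) * emeasure lborel (cball a r)"
      using r v by (simp add: emeasure_cball v_def n_def powr_add powr_realpow mult_ac flip: ennreal_mult)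
    also have "\<dots> = (\<integral>\<^sup>+x. ennreal (r powr \<tau>) * indicator (cball a r) x \<partial>lborel)"
      by (subst nn_integral_cmult_indicator) auto
    also have "\<dots> \<le> dist_integral \<delta> A \<tau>"
      unfolding dist_integral_def
    proof (intro nn_integral_mono)
      fix x
      have "ennreal (r powr \<tau>) \<le> ext_powr (infdist x A) \<tau>" if "x \<in> cball a r"
        using ext_powr_antimono[OF infdist_nonneg dist[OF that], of \<tau>] r neg
        by (auto simp: ext_powr_def n_def)
      then show "ennreal (r powr \<tau>) * indicator (cball a r) x \<le> ext_powr (infdist x A) \<tau> * indicator (tube \<delta> A) x"
        using dist[of x] r by (auto simp: tube_def split: split_indicator)
    qed
    finally show ?thesis using c by simp
  qed
  \<comment> \<open>\<open>R\<close> solves \<open>v * R powr (\<tau> + n) = c + 1\<close>.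
    Shrinking it to fit into the tube only increases the left side, the exponent being
    negative.\<close>
  define R where "R = ((c + 1) / v) powr (1 / (\<tau> + n))"
  define r where "r = min (\<delta> / 2) R"
  have "0 < R" using c v by (simp add: R_def)
  then have r: "0 < r" "r < \<delta>" using assms by (auto simp: r_def)
  have "(c + 1) / v = R powr (\<tau> + n)" using c v neg by (simp add: R_def powr_powr)
  also have "\<dots> \<le> r powr (\<tau> + n)" using r neg by (intro powr_mono2') (auto simp: r_def)
  finally have "c + 1 \<le> v * r powr (\<tau> + n)" using v by (simp add: field_simps)
  then show False using bound[OF r] by simp
qed

lemma dist_integral_radius_iff:
  fixes A :: "'a::euclidean_space set"
  assumes "bounded A" "A \<noteq> {}" "0 < \<delta>" "0 < \<epsilon>"
  shows "dist_integral \<delta> A \<tau> < \<infinity> \<longleftrightarrow> dist_integral \<epsilon> A \<tau> < \<infinity>"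
  using dist_integral_radius assms by blast

lemma abscissa_radius:
  fixes A :: "'a::euclidean_space set"
  assumes "bounded A" "A \<noteq> {}" "0 < \<delta>" "0 < \<epsilon>"
  shows "abscissa \<delta> A = abscissa \<epsilon> A"
  unfolding abscissa_def dist_integral_def[symmetric] dist_integral_radius_iff[OF assms] ..

text \<open>The witness can be capped at the dimension because a nonnegative exponent always
  converges; the cap later makes the exponent \<open>- b\<close> of the distance to \<open>A\<close>
  nonpositive.\<close>

lemma abscissa_less_obtain:
  fixes A :: "'a::euclidean_space set"
  assumes "bounded A" "A \<noteq> {}" "abscissa \<delta> A < \<sigma>"
  obtains \<sigma>' where "0 \<le> \<sigma>'" "\<sigma>' \<le> real DIM('a)" "\<sigma>' < \<sigma>" "dist_integral \<delta> A (\<sigma>' - real DIM('a)) < \<infinity>"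
proof -
  have dim: "dist_integral \<delta> A (real DIM('a) - real DIM('a)) < \<infinity>"
    using assms by (intro dist_integral_nonneg_exponent) auto
  then have "{\<sigma>. 0 \<le> \<sigma> \<and> dist_integral \<delta> A (\<sigma> - real DIM('a)) < \<infinity>} \<noteq> {}"
    by (auto intro!: exI[of _ "real DIM('a)"])
  from cInf_lessD[OF this] assms(3) obtain s
    where s: "0 \<le> s" "s < \<sigma>" "dist_integral \<delta> A (s - real DIM('a)) < \<infinity>"
    unfolding abscissa_def dist_integral_def[symmetric] by auto
  show thesis
    using that[of "min s (real DIM('a))"] s dim by (auto simp: min_def split: if_splits)
qed

subsection \<open>Products with the unit cube\<close>

lemma nn_integral_lborel_Times:
  fixes f :: "'a::euclidean_space \<Rightarrow> ennreal" and g :: "'b::euclidean_space \<Rightarrow> ennreal"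
  assumes [measurable]: "f \<in> borel_measurable borel" "g \<in> borel_measurable borel"
  shows "(\<integral>\<^sup>+z. f (fst z) * g (snd z) \<partial>lborel) = (\<integral>\<^sup>+x. f x \<partial>lborel) * (\<integral>\<^sup>+y. g y \<partial>lborel)"
proof -
  have "(\<integral>\<^sup>+z. f (fst z) * g (snd z) \<partial>lborel) = (\<integral>\<^sup>+z. f (fst z) * g (snd z) \<partial>(lborel \<Otimes>\<^sub>M lborel))"
    by (simp add: lborel_prod)
  also have "\<dots> = (\<integral>\<^sup>+x. \<integral>\<^sup>+y. f x * g y \<partial>lborel \<partial>lborel)"
    by (subst lborel.nn_integral_fst[symmetric]) auto
  also have "\<dots> = (\<integral>\<^sup>+x. f x \<partial>lborel) * (\<integral>\<^sup>+y. g y \<partial>lborel)"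
    by (simp add: nn_integral_cmult nn_integral_multc)
  finally show ?thesis .
qed

abbreviation unit_cube :: "'a::euclidean_space set" where
  "unit_cube \<equiv> cbox 0 One"

lemma unit_cube_nonempty: "(unit_cube :: 'a::euclidean_space set) \<noteq> {}"
  by (simp add: box_ne_empty)

lemma emeasure_unit_cube: "emeasure lborel (unit_cube :: 'a::euclidean_space set) = 1"
  by (simp add: emeasure_lborel_cbox_eq)

lemma infdist_unit_cube_pos: "y \<notin> unit_cube \<Longrightarrow> 0 < infdist y unit_cube"
  by (intro infdist_pos_not_in_closed) (auto simp: box_ne_empty)

section \<open>Negative powers of the distance outside the cube\<close>

text \<open>Bounding the distance below by the excess of a single coordinate reduces the exterior
  integral to one variable.\<close>

lemma coordinate_excess_le_infdist_unit_cube: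
  fixes y :: "'a::euclidean_space"
  assumes "i \<in> Basis"
  shows "- (y \<bullet> i) \<le> infdist y unit_cube" "y \<bullet> i - 1 \<le> infdist y unit_cube"
proof -
  obtain w :: 'a where w: "w \<in> unit_cube" "infdist y unit_cube = dist y w"
    using infdist_attains_inf[of unit_cube y] by (auto simp: box_ne_empty)
  have "0 \<le> w \<bullet> i" "w \<bullet> i \<le> 1" using w(1) assms by (auto simp: mem_box)
  moreover have "\<bar>(y - w) \<bullet> i\<bar> \<le> dist y w"
    unfolding dist_norm using assms by (rule Basis_le_norm)
  ultimately show "- (y \<bullet> i) \<le> infdist y unit_cube" "y \<bullet> i - 1 \<le> infdist y unit_cube"
    unfolding w(2) by (auto simp: inner_diff_left)
qed

lemma nn_integral_interval_exterior_powr: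
  fixes c \<epsilon> :: real
  assumes "c < 1" "0 < \<epsilon>"
  shows "(\<integral>\<^sup>+t. ennreal ((- t) powr (- c)) * indicator {0..\<epsilon>} (- t) +
     ennreal ((t - 1) powr (- c)) * indicator {0..\<epsilon>} (t - 1) \<partial>lborel) < \<infinity>"
proof -
  let ?g = "\<lambda>t. ennreal (t powr (- c)) * indicator {0..\<epsilon>} t"
  have g: "(\<integral>\<^sup>+t. ?g t \<partial>lborel) < \<infinity>"
    using nn_integral_has_integral_lebesgue'[OF _ has_integral_powr_from_0[of "- c" \<epsilon>]] assms by simp
  have "(\<integral>\<^sup>+t. ?g (- t) \<partial>lborel) = (\<integral>\<^sup>+t. ?g t \<partial>lborel)"
    using nn_integral_real_affine[of ?g "-1" 0] by simp
  moreover have "(\<integral>\<^sup>+t. ?g (t - 1) \<partial>lborel) = (\<integral>\<^sup>+t. ?g t \<partial>lborel)"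
    using nn_integral_real_affine[of ?g "1" "-1"] by simp
  ultimately show ?thesis using g by (subst nn_integral_add) auto
qed

text \<open>A point outside the cube leaves \<open>[0, 1]\<close> in some coordinate
  \<open>i\<close>. The integrand is at most the corresponding power of the excess in that
  coordinate, while the other coordinates are confined to a bounded interval. Summing over
  \<open>i\<close> gives a bound by product functions, whose integrals factor.\<close>

lemma nn_integral_unit_cube_exterior_powr:
  fixes c \<epsilon> :: real
  assumes c: "0 \<le> c" "c < 1" and \<epsilon>: "0 < \<epsilon>"
  shows "(\<integral>\<^sup>+y\<in>tube \<epsilon> (unit_cube :: 'b::euclidean_space set) - unit_cube. ennreal (infdist y unit_cube powr (- c)) \<partial>lborel) < \<infinity>"
proof -
  define g where "g t = ennreal ((- t) powr (- c)) * indicator {0..\<epsilon>} (- t) +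
     ennreal ((t - 1) powr (- c)) * indicator {0..\<epsilon>} (t - 1)" for t
  define h where "h i j t = (if j = i then g t else indicator {- \<epsilon>..1 + \<epsilon>} t)" for i j :: 'b and t :: real
  have g [measurable]: "g \<in> borel_measurable borel" unfolding g_def by measurable
  have h [measurable]: "h i j \<in> borel_measurable borel" for i j unfolding h_def by measurable
  have le: "ennreal (infdist y unit_cube powr (- c)) \<le> (\<Sum>i\<in>Basis. \<Prod>j\<in>Basis. h i j (y \<bullet> j))"
    if y: "y \<in> tube \<epsilon> unit_cube" "y \<notin> unit_cube" for y :: 'b
  proof -
    obtain i :: 'b where i: "i \<in> Basis" "y \<bullet> i < 0 \<or> 1 < y \<bullet> i"
      using y(2) by (auto simp: mem_box not_le)
    have small: "- \<epsilon> \<le> y \<bullet> j" "y \<bullet> j \<le> 1 + \<epsilon>" if "j \<in> Basis" for j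
      using y(1) coordinate_excess_le_infdist_unit_cube[OF that, of y] by (auto simp: tube_def)
    have "ennreal (infdist y unit_cube powr (- c)) \<le> g (y \<bullet> i)"
    proof (cases "y \<bullet> i < 0")
      case True
      then have "infdist y unit_cube powr (- c) \<le> (- (y \<bullet> i)) powr (- c)"
        using coordinate_excess_le_infdist_unit_cube[OF i(1), of y] c by (intro powr_mono2') auto
      then show ?thesis using True small[OF i(1)] by (auto simp: g_def intro!: ennreal_leI)
    next
      case False
      then have "infdist y unit_cube powr (- c) \<le> (y \<bullet> i - 1) powr (- c)"
        using coordinate_excess_le_infdist_unit_cube[OF i(1), of y] c i by (intro powr_mono2') auto
      then show ?thesis using False i small[OF i(1)] by (auto simp: g_def intro!: ennreal_leI)
    qed
    also have "g (y \<bullet> i) = (\<Prod>j\<in>Basis. h i j (y \<bullet> j))"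
    proof -
      have "(\<Prod>j\<in>Basis. h i j (y \<bullet> j)) = h i i (y \<bullet> i) * (\<Prod>j\<in>Basis - {i}. h i j (y \<bullet> j))"
        using i by (subst prod.remove) auto
      also have "(\<Prod>j\<in>Basis - {i}. h i j (y \<bullet> j)) = 1"
        using small by (intro prod.neutral) (auto simp: h_def)
      finally show ?thesis by (simp add: h_def)
    qed
    also have "\<dots> \<le> (\<Sum>i\<in>Basis. \<Prod>j\<in>Basis. h i j (y \<bullet> j))"
      using i by (intro member_le_sum) auto
    finally show ?thesis .
  qed
  have hfin: "(\<integral>\<^sup>+t. h i j t \<partial>lborel) < \<infinity>" for i j
    using nn_integral_interval_exterior_powr[of c \<epsilon>] c \<epsilon> by (cases "j = i") (auto simp: h_def g_def)
  have "(\<integral>\<^sup>+y\<in>tube \<epsilon> (unit_cube :: 'b set) - unit_cube. ennreal (infdist y unit_cube powr (- c)) \<partial>lborel)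
      \<le> (\<integral>\<^sup>+y. (\<Sum>i\<in>Basis. \<Prod>j\<in>Basis. h i j (y \<bullet> j)) \<partial>(lborel :: 'b measure))"
    using le by (intro nn_integral_mono) (auto split: split_indicator)
  also have "\<dots> = (\<Sum>i\<in>(Basis :: 'b set). \<Prod>j\<in>(Basis :: 'b set). \<integral>\<^sup>+t. h i j t \<partial>lborel)"
    by (subst nn_integral_sum) (auto intro!: sum.cong nn_integral_lborel_prod)
  also have "\<dots> < \<infinity>"
    using hfin by (simp add: ennreal_prod_eq_top less_le)
  finally show ?thesis .
qed

section \<open>Convergence and abscissa for the product with the cube\<close>

lemma infdist_Times_unit_cube:
  fixes A :: "'a::euclidean_space set"
  assumes "A \<noteq> {}"
  shows "infdist (x, y) (A \<times> (unit_cube :: 'b::euclidean_space set)) = sqrt ((infdist x A)\<^sup>2 + (infdist y unit_cube)\<^sup>2)"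
  by (rule infdist_Times[OF assms unit_cube_nonempty])

lemma infdist_le_infdist_Times:
  fixes A :: "'a::euclidean_space set" and B :: "'b::euclidean_space set"
  assumes "A \<noteq> {}" "B \<noteq> {}"
  shows "infdist x A \<le> infdist (x, y) (A \<times> B)" "infdist y B \<le> infdist (x, y) (A \<times> B)"
  unfolding infdist_Times[OF assms] by (auto intro: real_le_rsqrt)

text \<open>Over the cube, of volume 1, the distance is that to \<open>A\<close>, which gives one
  direction. Conversely, a negative power of the distance to the product is at most that of the
  distance to \<open>A\<close>, and \<open>y\<close> ranges over a tube of finite measure.\<close>

lemma dist_integral_product_iff:
  fixes A :: "'a::euclidean_space set"
  assumes A: "bounded A" "A \<noteq> {}" and \<epsilon>: "0 < \<epsilon>"
  shows "dist_integral \<epsilon> (A \<times> (unit_cube :: 'b::euclidean_space set)) \<tau> < \<infinity> \<longleftrightarrow> dist_integral \<epsilon> A \<tau> < \<infinity>"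
proof
  let ?W = "unit_cube :: 'b set"
  assume fin: "dist_integral \<epsilon> (A \<times> ?W) \<tau> < \<infinity>"
  have "dist_integral \<epsilon> A \<tau> = (\<integral>\<^sup>+x. ext_powr (infdist x A) \<tau> * indicator (tube \<epsilon> A) x \<partial>lborel) * (\<integral>\<^sup>+y. indicator ?W y \<partial>lborel)"
    by (simp add: dist_integral_def emeasure_unit_cube)
  also have "\<dots> = (\<integral>\<^sup>+z. (ext_powr (infdist (fst z) A) \<tau> * indicator (tube \<epsilon> A) (fst z)) * indicator ?W (snd z) \<partial>lborel)"
    by (rule nn_integral_lborel_Times[symmetric]) auto
  also have "\<dots> \<le> dist_integral \<epsilon> (A \<times> ?W) \<tau>"
    unfolding dist_integral_def
    by (intro nn_integral_mono)
       (auto simp: tube_def infdist_Times_unit_cube[OF A(2)] infdist_nonneg split: split_indicator)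
  finally show "dist_integral \<epsilon> A \<tau> < \<infinity>" using fin by (rule le_less_trans)
next
  let ?W = "unit_cube :: 'b set"
  assume fin: "dist_integral \<epsilon> A \<tau> < \<infinity>"
  have AW: "bounded (A \<times> ?W)" "A \<times> ?W \<noteq> {}"
    using A by (auto intro!: bounded_Times simp: box_ne_empty)
  show "dist_integral \<epsilon> (A \<times> ?W) \<tau> < \<infinity>"
  proof (cases "0 \<le> \<tau>")
    case True
    then show ?thesis using AW by (intro dist_integral_nonneg_exponent) auto
  next
    case False
    note le = infdist_le_infdist_Times[OF A(2) unit_cube_nonempty]
    have "dist_integral \<epsilon> (A \<times> ?W) \<tau> \<le> (\<integral>\<^sup>+z. (ext_powr (infdist (fst z) A) \<tau> * indicator (tube \<epsilon> A) (fst z)) * indicator (tube \<epsilon> ?W) (snd z) \<partial>lborel)"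
      unfolding dist_integral_def
    proof (intro nn_integral_mono)
      fix z :: "'a \<times> 'b"
      obtain x y where z: "z = (x, y)" by (cases z)
      have "ext_powr (infdist z (A \<times> ?W)) \<tau> \<le> ext_powr (infdist x A) \<tau>"
        using False le(1)[of x y] le(2)[of y x] unfolding z by (intro ext_powr_antimono) (auto simp: infdist_nonneg)
      then show "ext_powr (infdist z (A \<times> ?W)) \<tau> * indicator (tube \<epsilon> (A \<times> ?W)) z
         \<le> ext_powr (infdist (fst z) A) \<tau> * indicator (tube \<epsilon> A) (fst z) * indicator (tube \<epsilon> ?W) (snd z)"
        using le(1)[of x y] le(2)[of y x] unfolding z by (auto simp: tube_def split: split_indicator)
    qed
    also have "\<dots> = dist_integral \<epsilon> A \<tau> * emeasure lborel (tube \<epsilon> ?W)"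
      unfolding dist_integral_def by (subst nn_integral_lborel_Times) auto
    also have "\<dots> < \<infinity>"
      using fin emeasure_tube_finite[of ?W \<epsilon>] by (auto simp: ennreal_mult_less_top box_ne_empty)
    finally show ?thesis .
  qed
qed

lemma abscissa_product:
  fixes A :: "'a::euclidean_space set"
  assumes A: "bounded A" "A \<noteq> {}" and \<epsilon>: "0 < \<epsilon>"
  shows "abscissa \<epsilon> (A \<times> (unit_cube :: 'b::euclidean_space set)) = abscissa \<epsilon> A + real DIM('b)"
proof -
  note iff = dist_integral_product_iff[OF assms, where 'b='b, simplified]
  let ?S = "{\<sigma>. 0 \<le> \<sigma> \<and> dist_integral \<epsilon> A (\<sigma> - real DIM('a)) < \<infinity>}"
  have "{\<sigma>. 0 \<le> \<sigma> \<and> dist_integral \<epsilon> (A \<times> (unit_cube :: 'b set)) (\<sigma> - real DIM('a \<times> 'b)) < \<infinity>}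
     = (\<lambda>\<sigma>. real DIM('b) + \<sigma>) ` ?S" (is "?L = _")
  proof (intro equalityI subsetI)
    fix \<sigma> assume "\<sigma> \<in> ?L"
    then have fin: "dist_integral \<epsilon> A (\<sigma> - real DIM('b) - real DIM('a)) < \<infinity>"
      by (simp add: iff algebra_simps)
    \<comment> \<open>Membership in \<open>?L\<close> only gives \<open>0 \<le> \<sigma>\<close>;
      the stronger bound comes from divergence below minus the dimension of
      \<open>A\<close>.\<close>
    then have "0 \<le> \<sigma> - real DIM('b)"
      using dist_integral_below_neg_dim[OF A(2) \<epsilon>, of "\<sigma> - real DIM('b) - real DIM('a)"]
      by (cases "real DIM('b) \<le> \<sigma>") auto
    with fin show "\<sigma> \<in> (\<lambda>\<sigma>. real DIM('b) + \<sigma>) ` ?S"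
      by (intro image_eqI[where x = "\<sigma> - real DIM('b)"]) auto
  qed (auto simp: iff algebra_simps)
  then have "abscissa \<epsilon> (A \<times> (unit_cube :: 'b set)) = Inf ((\<lambda>\<sigma>. real DIM('b) + \<sigma>) ` ?S)"
    by (simp add: abscissa_def dist_integral_def)
  also have "\<dots> = real DIM('b) + Inf ?S"
  proof -
    have "dist_integral \<epsilon> A (real DIM('a) - real DIM('a)) < \<infinity>"
      using A by (intro dist_integral_nonneg_exponent) auto
    then have "?S \<noteq> {}" by (auto intro!: exI[of _ "real DIM('a)"])
    moreover have "bdd_below ?S" by (auto intro: bdd_belowI[of _ 0])
    ultimately show ?thesis using Inf_add_eq[of "\<lambda>\<sigma>. \<sigma>" ?S "real DIM('b)"] by simp
  qed
  finally show ?thesis by (simp add: abscissa_def dist_integral_def)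
qed

text \<open>The distance to the product dominates the distances in both factors, so its power splits
  into a bound by a product of functions of \<open>x\<close> and of \<open>y\<close>. The factor in
  \<open>y\<close> provides the gain \<open>c\<close>, which may be anything below 1.\<close>

lemma nn_integral_product_exterior:
  fixes A :: "'a::euclidean_space set"
  assumes A: "bounded A" "A \<noteq> {}" and \<epsilon>: "0 < \<epsilon>"
    and b: "0 \<le> b" "dist_integral \<epsilon> A (- b) < \<infinity>" and c: "0 \<le> c" "c < 1"
  shows "(\<integral>\<^sup>+z\<in>tube \<epsilon> (A \<times> (unit_cube :: 'b::euclidean_space set)) - UNIV \<times> unit_cube.
     ext_powr (infdist z (A \<times> unit_cube)) (- b - c) \<partial>lborel) < \<infinity>"
proof -
  let ?W = "unit_cube :: 'b set"
  note le = infdist_le_infdist_Times[OF A(2) unit_cube_nonempty]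
  \<comment> \<open>The summand \<open>1\<close> is for \<open>b = 0\<close>, where \<open>ext_powr 0 0 = 0\<close>.\<close>
  let ?f = "\<lambda>x. (1 + ext_powr (infdist x A) (- b)) * indicator (tube \<epsilon> A) x"
  let ?g = "\<lambda>y. ennreal (infdist y ?W powr (- c)) * indicator (tube \<epsilon> ?W - ?W) y"
  have "(\<integral>\<^sup>+z\<in>tube \<epsilon> (A \<times> ?W) - UNIV \<times> ?W. ext_powr (infdist z (A \<times> ?W)) (- b - c) \<partial>lborel)
      \<le> (\<integral>\<^sup>+z. ?f (fst z) * ?g (snd z) \<partial>lborel)"
  proof (intro nn_integral_mono)
    fix z :: "'a \<times> 'b"
    obtain x y where z: "z = (x, y)" by (cases z)
    have "ext_powr (infdist z (A \<times> ?W)) (- b - c) \<le> (1 + ext_powr (infdist x A) (- b)) * ennreal (infdist y ?W powr (- c))"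
      if y: "y \<notin> ?W"
    proof -
      define s where "s = infdist z (A \<times> ?W)"
      have s: "0 < s" "infdist x A \<le> s" "infdist y ?W \<le> s"
        using infdist_unit_cube_pos[OF y] le(1)[of x y] le(2)[of y x] by (auto simp: s_def z)
      have "ext_powr s (- b - c) = ennreal (s powr (- b)) * ennreal (s powr (- c))"
        using s by (simp add: ext_powr_def powr_diff powr_minus divide_inverse ennreal_mult)
      also have "\<dots> \<le> (1 + ext_powr (infdist x A) (- b)) * ennreal (infdist y ?W powr (- c))"
      proof (intro mult_mono ennreal_leI)
        show "s powr (- c) \<le> infdist y ?W powr (- c)"
          using s c infdist_unit_cube_pos[OF y] by (intro powr_mono2') auto
        show "ennreal (s powr (- b)) \<le> 1 + ext_powr (infdist x A) (- b)"
        proof (cases "b = 0")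
          case True
          then show ?thesis using s by (simp add: add_increasing2)
        next
          case False
          then have "ennreal (s powr (- b)) \<le> ext_powr (infdist x A) (- b)"
            using ext_powr_antimono[OF infdist_nonneg s(2), of "- b"] b s by (simp add: ext_powr_def)
          then show ?thesis by (simp add: add_increasing)
        qed
      qed auto
      finally show ?thesis by (simp add: s_def)
    qed
    then show "ext_powr (infdist z (A \<times> ?W)) (- b - c) * indicator (tube \<epsilon> (A \<times> ?W) - UNIV \<times> ?W) z
      \<le> ?f (fst z) * ?g (snd z)"
      using le(1)[of x y] le(2)[of y x] unfolding z by (auto simp: tube_def split: split_indicator)
  qed
  also have "\<dots> = (\<integral>\<^sup>+x. ?f x \<partial>lborel) * (\<integral>\<^sup>+y. ?g y \<partial>lborel)"
    by (rule nn_integral_lborel_Times) auto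
  also have "(\<integral>\<^sup>+x. ?f x \<partial>lborel) = emeasure lborel (tube \<epsilon> A) + dist_integral \<epsilon> A (- b)"
    unfolding dist_integral_def by (simp add: distrib_right nn_integral_add)
  also have "(emeasure lborel (tube \<epsilon> A) + dist_integral \<epsilon> A (- b)) * (\<integral>\<^sup>+y. ?g y \<partial>lborel) < \<infinity>"
    using emeasure_tube_finite[OF A, of \<epsilon>] b nn_integral_unit_cube_exterior_powr[OF c \<epsilon>, where 'b='b]
    by (simp add: ennreal_mult_less_top)
  finally show ?thesis .
qed

subsection \<open>Zeta functions\<close>

text \<open>Distances below \<open>\<delta>\<close> allow raising the exponent at the cost of a
  constant factor. The set \<open>E\<close> is general to cover both whole tubes and the part
  outside the cube.\<close>

lemma nn_integral_ext_powr_mono_exponent: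
  fixes A :: "'a::euclidean_space set"
  assumes [measurable]: "E \<in> sets borel" and E: "E \<subseteq> tube \<delta> A" and \<delta>: "0 < \<delta>"
    and \<tau>: "\<tau>' \<le> \<tau>" and fin: "(\<integral>\<^sup>+x\<in>E. ext_powr (infdist x A) \<tau>' \<partial>lborel) < \<infinity>"
  shows "(\<integral>\<^sup>+x\<in>E. ext_powr (infdist x A) \<tau> \<partial>lborel) < \<infinity>"
proof -
  let ?C = "ennreal (\<delta> powr (\<tau> - \<tau>'))"
  have le: "ext_powr t \<tau> \<le> ?C * ext_powr t \<tau>'" if t: "0 \<le> t" "t < \<delta>" for t
  proof (cases "t = 0")
    \<comment> \<open>For \<open>\<tau>' < 0\<close> the right side is infinite, as
      \<open>\<delta> powr (\<tau> - \<tau>')\<close> is positive; otherwise \<open>\<tau>\<close>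
      is nonnegative too and the left side is 0.\<close>
    case True
    then show ?thesis using \<delta> \<tau> by (auto simp: ext_powr_def ennreal_mult_top)
  next
    case False
    then have "t powr \<tau> = t powr (\<tau> - \<tau>') * t powr \<tau>'" by (simp flip: powr_add)
    also have "\<dots> \<le> \<delta> powr (\<tau> - \<tau>') * t powr \<tau>'"
      using t \<tau> by (intro mult_right_mono powr_mono2) auto
    finally show ?thesis using False by (simp add: ext_powr_def ennreal_leI flip: ennreal_mult)
  qed
  have "(\<integral>\<^sup>+x\<in>E. ext_powr (infdist x A) \<tau> \<partial>lborel) \<le> (\<integral>\<^sup>+x. ?C * (ext_powr (infdist x A) \<tau>' * indicator E x) \<partial>lborel)"
    using E by (intro nn_integral_mono) (auto simp: tube_def infdist_nonneg intro!: le split: split_indicator)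
  also have "\<dots> = ?C * (\<integral>\<^sup>+x\<in>E. ext_powr (infdist x A) \<tau>' \<partial>lborel)"
    by (rule nn_integral_cmult) auto
  also have "\<dots> < \<infinity>" using fin by (simp add: ennreal_mult_less_top)
  finally show ?thesis .
qed

lemma dist_integral_above_abscissa:
  fixes A :: "'a::euclidean_space set"
  assumes "bounded A" "A \<noteq> {}" "0 < \<delta>" "abscissa \<delta> A < \<sigma>"
  shows "dist_integral \<delta> A (\<sigma> - real DIM('a)) < \<infinity>"
proof -
  obtain \<sigma>' where "\<sigma>' < \<sigma>" "dist_integral \<delta> A (\<sigma>' - real DIM('a)) < \<infinity>"
    using abscissa_less_obtain assms by metis
  then show ?thesis unfolding dist_integral_def
    using assms(3) nn_integral_ext_powr_mono_exponent[of "tube \<delta> A" \<delta> A "\<sigma>' - real DIM('a)" "\<sigma> - real DIM('a)"]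
    by simp
qed

lemma set_integrable_infdist_powr:
  fixes A :: "'a::euclidean_space set"
  assumes [measurable]: "E \<in> sets borel"
    and fin: "(\<integral>\<^sup>+x\<in>E. ext_powr (infdist x A) (Re w) \<partial>lborel) < \<infinity>"
  shows "set_integrable lborel E (\<lambda>x. complex_of_real (infdist x A) powr w)"
  unfolding set_integrable_def
proof (rule integrableI_bounded)
  have "(\<integral>\<^sup>+x. ennreal (norm (indicat_real E x *\<^sub>R complex_of_real (infdist x A) powr w)) \<partial>lborel)
      \<le> (\<integral>\<^sup>+x\<in>E. ext_powr (infdist x A) (Re w) \<partial>lborel)"
    by (intro nn_integral_mono)
       (auto simp: ext_powr_def norm_powr_real_powr infdist_nonneg split: split_indicator)
  then show "(\<integral>\<^sup>+x. ennreal (norm (indicat_real E x *\<^sub>R complex_of_real (infdist x A) powr w)) \<partial>lborel) < \<infinity>"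
    using fin by (rule le_less_trans)
qed measurable

lemma set_integral_infdist_powr_holomorphic:
  fixes A :: "'a::euclidean_space set"
  assumes [measurable]: "E \<in> sets borel"
    and fin: "\<And>\<tau>. a < \<tau> \<Longrightarrow> (\<integral>\<^sup>+x\<in>E. ext_powr (infdist x A) \<tau> \<partial>lborel) < \<infinity>"
  shows "(\<lambda>z. LINT x:E|lborel. complex_of_real (infdist x A) powr z) holomorphic_on {z. a < Re z}"
proof -
  \<comment> \<open>The indicator can be moved into the base of the power because
    \<open>0 powr z = 0\<close>.\<close>
  let ?f = "\<lambda>x. indicat_real E x * infdist x A"
  have "(\<lambda>z. \<integral>x. complex_of_real (?f x) powr z \<partial>lborel) holomorphic_on {z. a < Re z}"
  proof (rule integral_powr_holomorphic)
    show "integrable lborel (\<lambda>x. ?f x powr \<sigma>)" if "a < \<sigma>" for \<sigma>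
    proof (rule integrableI_bounded)
      have "(\<integral>\<^sup>+x. ennreal (norm (?f x powr \<sigma>)) \<partial>lborel) \<le> (\<integral>\<^sup>+x\<in>E. ext_powr (infdist x A) \<sigma> \<partial>lborel)"
        by (intro nn_integral_mono) (auto simp: ext_powr_def split: split_indicator)
      then show "(\<integral>\<^sup>+x. ennreal (norm (?f x powr \<sigma>)) \<partial>lborel) < \<infinity>"
        using fin[OF that] by (rule le_less_trans)
    qed measurable
  qed (auto simp: infdist_nonneg)
  moreover have "complex_of_real (?f x) powr z = indicat_real E x *\<^sub>R complex_of_real (infdist x A) powr z" for x z
    by (auto split: split_indicator)
  ultimately show ?thesis by (simp add: set_lebesgue_integral_def)
qed

section \<open>Dependence of the zeta function on the tube radius\<close>

text \<open>The difference is the integral over the shell between the tubes, which converges for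
  every exponent and is therefore holomorphic on every right half-plane.\<close>

lemma distance_zeta_radius_le:
  fixes A :: "'a::euclidean_space set"
  assumes A: "bounded A" "A \<noteq> {}" and \<delta>: "0 < \<delta>" "\<delta> \<le> \<epsilon>"
  shows "\<exists>e. e holomorphic_on UNIV \<and>
    (\<forall>s. abscissa \<delta> A < Re s \<longrightarrow> distance_zeta \<epsilon> A s = distance_zeta \<delta> A s + e s)"
proof -
  let ?E = "tube \<epsilon> A - tube \<delta> A"
  let ?h = "\<lambda>z. LINT x:?E|lborel. complex_of_real (infdist x A) powr z"
  have fin: "(\<integral>\<^sup>+x\<in>?E. ext_powr (infdist x A) \<tau> \<partial>lborel) < \<infinity>" for \<tau>
    using dist_integral_shell_finite[OF A, of \<delta> \<epsilon>] \<delta> by auto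
  have "?h holomorphic_on {z. a < Re z}" for a
    using fin by (intro set_integral_infdist_powr_holomorphic) auto
  then have "?h holomorphic_on (\<Union>a. {z. a < Re z})"
    by (intro holomorphic_on_UN_open) (auto simp: open_halfspace_Re_gt)
  moreover have "(\<Union>a. {z. a < Re z}) = UNIV" by (auto intro: lt_ex)
  ultimately have "?h holomorphic_on UNIV" by simp
  then have "(?h \<circ> (\<lambda>s. s - of_nat DIM('a))) holomorphic_on UNIV"
    by (intro holomorphic_on_compose_gen[of _ UNIV _ UNIV] holomorphic_intros) auto
  moreover have "distance_zeta \<epsilon> A s = distance_zeta \<delta> A s + (?h \<circ> (\<lambda>s. s - of_nat DIM('a))) s"
    if s: "abscissa \<delta> A < Re s" for s
  proof -
    have "tube \<epsilon> A = tube \<delta> A \<union> ?E" using \<delta> by (auto simp: tube_def)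
    then have "distance_zeta \<epsilon> A s = (LINT x:tube \<delta> A \<union> ?E|lborel. complex_of_real (infdist x A) powr (s - of_nat DIM('a)))"
      by (simp add: distance_zeta_def)
    also have "\<dots> = distance_zeta \<delta> A s + ?h (s - of_nat DIM('a))"
      unfolding distance_zeta_def
      using dist_integral_above_abscissa[OF A \<delta>(1) s] fin[of "Re s - real DIM('a)"]
      by (intro set_integral_Un set_integrable_infdist_powr) (auto simp: dist_integral_def)
    finally show ?thesis by simp
  qed
  ultimately show ?thesis by blast
qed

lemma distance_zeta_radius:
  fixes A :: "'a::euclidean_space set"
  assumes A: "bounded A" "A \<noteq> {}" and pos: "0 < \<delta>" "0 < \<epsilon>"
  shows "\<exists>e. e holomorphic_on UNIV \<and>
    (\<forall>s. abscissa \<delta> A < Re s \<longrightarrow> distance_zeta \<epsilon> A s = distance_zeta \<delta> A s + e s)"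
proof (cases "\<delta> \<le> \<epsilon>")
  case False
  then obtain e where "e holomorphic_on UNIV"
    "\<forall>s. abscissa \<delta> A < Re s \<longrightarrow> distance_zeta \<delta> A s = distance_zeta \<epsilon> A s + e s"
    using distance_zeta_radius_le[OF A, of \<epsilon> \<delta>] pos abscissa_radius[OF A, of \<delta> \<epsilon>] by auto
  then show ?thesis by (intro exI[of _ "\<lambda>s. - e s"]) (auto intro: holomorphic_intros)
next
  case True
  then show ?thesis by (rule distance_zeta_radius_le[OF A pos(1)])
qed

section \<open>Decomposition of the zeta function of the product\<close>

text \<open>Over the cube the integrand depends on \<open>x\<close> only, so Fubini and the volume 1
  of the cube give the claim.\<close>

lemma set_integral_product_interior:
  fixes A :: "'a::euclidean_space set"
  assumes A: "bounded A" "A \<noteq> {}" and \<epsilon>: "0 < \<epsilon>" and fin: "dist_integral \<epsilon> A (Re w) < \<infinity>"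
  shows "(LINT z:tube \<epsilon> A \<times> (unit_cube :: 'b::euclidean_space set)|lborel.
      complex_of_real (infdist z (A \<times> (unit_cube :: 'b set))) powr w) =
    (LINT x:tube \<epsilon> A|lborel. complex_of_real (infdist x A) powr w)"
proof -
  let ?W = "unit_cube :: 'b set"
  let ?F = "\<lambda>z. indicat_real (tube \<epsilon> A \<times> ?W) z *\<^sub>R complex_of_real (infdist z (A \<times> ?W)) powr w"
  let ?f = "\<lambda>x. indicat_real (tube \<epsilon> A) x *\<^sub>R complex_of_real (infdist x A) powr w"
  have sub: "tube \<epsilon> A \<times> ?W \<subseteq> tube \<epsilon> (A \<times> ?W)"
    by (auto simp: tube_def infdist_Times_unit_cube[OF A(2)] infdist_nonneg)
  have "set_integrable lborel (tube \<epsilon> (A \<times> ?W)) (\<lambda>z. complex_of_real (infdist z (A \<times> ?W)) powr w)"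
    using fin dist_integral_product_iff[OF A \<epsilon>, of "Re w", where 'b='b]
    by (intro set_integrable_infdist_powr) (auto simp: dist_integral_def)
  then have "set_integrable lborel (tube \<epsilon> A \<times> ?W) (\<lambda>z. complex_of_real (infdist z (A \<times> ?W)) powr w)"
    by (rule set_integrable_subset) (use sub in \<open>auto intro!: borel_Times\<close>)
  then have int: "integrable (lborel \<Otimes>\<^sub>M lborel) ?F"
    by (simp add: set_integrable_def lborel_prod)
  have "integral\<^sup>L lborel ?F = integral\<^sup>L (lborel \<Otimes>\<^sub>M lborel) ?F" by (simp add: lborel_prod)
  also have "\<dots> = (\<integral>x. \<integral>y. ?F (x, y) \<partial>lborel \<partial>lborel)"
    using lborel_pair.integral_fst'[OF int] by simp
  also have "\<dots> = (\<integral>x. \<integral>y. indicat_real ?W y *\<^sub>R ?f x \<partial>lborel \<partial>lborel)"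
    by (intro Bochner_Integration.integral_cong refl)
       (auto simp: infdist_Times_unit_cube[OF A(2)] infdist_nonneg split: split_indicator)
  also have "\<dots> = (\<integral>x. ?f x \<partial>lborel)"
    by simp
  finally show ?thesis by (simp add: set_lebesgue_integral_def)
qed

lemma product_exterior_finite:
  fixes A :: "'a::euclidean_space set"
  assumes A: "bounded A" "A \<noteq> {}" and \<epsilon>: "0 < \<epsilon>" and \<tau>: "abscissa \<epsilon> A - real DIM('a) - 1 < \<tau>"
  shows "(\<integral>\<^sup>+z\<in>tube \<epsilon> (A \<times> (unit_cube :: 'b::euclidean_space set)) - UNIV \<times> unit_cube.
     ext_powr (infdist z (A \<times> unit_cube)) \<tau> \<partial>lborel) < \<infinity>"
proof -
  obtain \<sigma> where \<sigma>: "\<sigma> \<le> real DIM('a)" "\<sigma> < \<tau> + real DIM('a) + 1" "dist_integral \<epsilon> A (\<sigma> - real DIM('a)) < \<infinity>"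
    using abscissa_less_obtain[OF A, of \<epsilon> "\<tau> + real DIM('a) + 1"] \<tau> by auto
  define b where "b = real DIM('a) - \<sigma>"
  \<comment> \<open>The part of the exponent not taken by \<open>b\<close>. It is below 1 because
    \<open>\<sigma>\<close> was chosen less than \<open>\<tau> + real DIM('a) + 1\<close>.\<close>
  define c where "c = max 0 (- b - \<tau>)"
  have bc: "0 \<le> b" "0 \<le> c" "c < 1" "- b - c \<le> \<tau>" using \<sigma> by (auto simp: b_def c_def)
  have "dist_integral \<epsilon> A (- b) < \<infinity>" using \<sigma>(3) by (simp add: b_def)
  from nn_integral_product_exterior[OF A \<epsilon> bc(1) this bc(2,3), where 'b='b]
  show ?thesis
    by (intro nn_integral_ext_powr_mono_exponent[OF _ _ \<epsilon> bc(4)])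
       (auto intro!: sets.Diff borel_Times)
qed

lemma distance_zeta_product:
  fixes A :: "'a::euclidean_space set"
  assumes A: "bounded A" "A \<noteq> {}" and \<epsilon>: "0 < \<epsilon>"
  shows "\<exists>h. h holomorphic_on {s. abscissa \<epsilon> A + real DIM('b) - 1 < Re s} \<and>
    (\<forall>s. abscissa \<epsilon> A + real DIM('b) < Re s \<longrightarrow>
      distance_zeta \<epsilon> (A \<times> (unit_cube :: 'b::euclidean_space set)) s =
      distance_zeta \<epsilon> A (s - of_nat DIM('b)) + h s)"
proof -
  let ?W = "unit_cube :: 'b set"
  let ?d = "of_nat DIM('a) + of_nat DIM('b) :: complex"
  let ?E = "tube \<epsilon> (A \<times> ?W) - UNIV \<times> ?W"
  let ?h = "\<lambda>z. LINT z':?E|lborel. complex_of_real (infdist z' (A \<times> ?W)) powr z"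
  have E [measurable]: "?E \<in> sets borel" by (intro sets.Diff borel_Times) auto
  note fin = product_exterior_finite[OF A \<epsilon>, where 'b='b]
  have "?h holomorphic_on {z. abscissa \<epsilon> A - real DIM('a) - 1 < Re z}"
    using fin by (intro set_integral_infdist_powr_holomorphic) auto
  then have "(?h \<circ> (\<lambda>s. s - ?d)) holomorphic_on {s. abscissa \<epsilon> A + real DIM('b) - 1 < Re s}"
    by (rule holomorphic_on_compose_gen[rotated]) (auto intro!: holomorphic_intros)
  moreover have "distance_zeta \<epsilon> (A \<times> ?W) s = distance_zeta \<epsilon> A (s - of_nat DIM('b)) + (?h \<circ> (\<lambda>s. s - ?d)) s"
    if s: "abscissa \<epsilon> A + real DIM('b) < Re s" for s
  proof -
    have finA: "dist_integral \<epsilon> A (Re (s - ?d)) < \<infinity>"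
      using dist_integral_above_abscissa[OF A \<epsilon>, of "Re s - real DIM('b)"] s by (simp add: algebra_simps)
    have sub: "tube \<epsilon> A \<times> ?W \<subseteq> tube \<epsilon> (A \<times> ?W)"
      by (auto simp: tube_def infdist_Times_unit_cube[OF A(2)] infdist_nonneg)
    \<comment> \<open>For \<open>y\<close> in the cube the two distances agree, so the slice of the
      tube at \<open>y\<close> is exactly the tube of \<open>A\<close>.\<close>
    have split: "tube \<epsilon> (A \<times> ?W) = tube \<epsilon> A \<times> ?W \<union> ?E"
      using sub by (auto simp: tube_def infdist_Times_unit_cube[OF A(2)] infdist_nonneg)
    have int: "set_integrable lborel (tube \<epsilon> (A \<times> ?W)) (\<lambda>z. complex_of_real (infdist z (A \<times> ?W)) powr (s - ?d))"
      using finA dist_integral_product_iff[OF A \<epsilon>, of "Re (s - ?d)", where 'b='b]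
      by (intro set_integrable_infdist_powr) (auto simp: dist_integral_def)
    have "distance_zeta \<epsilon> (A \<times> ?W) s = (LINT z:tube \<epsilon> A \<times> ?W \<union> ?E|lborel. complex_of_real (infdist z (A \<times> ?W)) powr (s - ?d))"
      unfolding distance_zeta_def split[symmetric] by simp
    also have "\<dots> = (LINT z:tube \<epsilon> A \<times> ?W|lborel. complex_of_real (infdist z (A \<times> ?W)) powr (s - ?d)) + ?h (s - ?d)"
      using sub E by (intro set_integral_Un set_integrable_subset[OF int]) (auto intro!: borel_Times)
    also have "(LINT z:tube \<epsilon> A \<times> ?W|lborel. complex_of_real (infdist z (A \<times> ?W)) powr (s - ?d)) =
        distance_zeta \<epsilon> A (s - of_nat DIM('b))"
      unfolding set_integral_product_interior[OF A \<epsilon> finA] distance_zeta_def by (simp add: algebra_simps)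
    finally show ?thesis by simp
  qed
  ultimately show ?thesis by blast
qed

text \<open>By contradiction: a continuation of the zeta function of the product across
  \<open>s0\<close> would yield one for \<open>A\<close> across \<open>s0 - ?m\<close>, after
  subtracting the holomorphic corrections for the exterior of the cube and for the change of
  radius.\<close>

lemma maximally_hyperfractal_Times_unit_cube:
  fixes A :: "'a::euclidean_space set"
  assumes \<delta>: "0 < \<delta>" and \<epsilon>: "0 < \<epsilon>" and hyper: "maximally_hyperfractal \<delta> A"
  shows "maximally_hyperfractal \<epsilon> (A \<times> (unit_cube :: 'b::euclidean_space set))"
proof -
  let ?B = "A \<times> (unit_cube :: 'b set)"
  let ?m = "of_nat DIM('b) :: complex"
  have A: "bounded A" "A \<noteq> {}" using hyper by (auto simp: maximally_hyperfractal_def)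
  define D where "D = abscissa \<delta> A"
  have D\<epsilon>: "abscissa \<epsilon> A = D" unfolding D_def by (rule abscissa_radius[OF A \<epsilon> \<delta>])
  have DB: "abscissa \<epsilon> ?B = D + real DIM('b)" by (simp add: abscissa_product[OF A \<epsilon>] D\<epsilon>)
  obtain e where e: "e holomorphic_on UNIV"
    "\<And>s. D < Re s \<Longrightarrow> distance_zeta \<epsilon> A s = distance_zeta \<delta> A s + e s"
    using distance_zeta_radius[OF A \<delta> \<epsilon>] by (auto simp: D_def)
  obtain h where h: "h holomorphic_on {s. D + real DIM('b) - 1 < Re s}"
    "\<And>s. D + real DIM('b) < Re s \<Longrightarrow> distance_zeta \<epsilon> ?B s = distance_zeta \<epsilon> A (s - ?m) + h s"
    using distance_zeta_product[OF A \<epsilon>, where 'b='b] by (auto simp: D\<epsilon>)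
  have "nonremovable_singularity \<epsilon> ?B s0" if s0: "Re s0 = abscissa \<epsilon> ?B" for s0
    unfolding nonremovable_singularity_def
  proof (rule notI, elim exE conjE)
    fix r g
    assume r: "r > 0" and g: "g holomorphic_on ball s0 r"
      and eq: "\<forall>s\<in>ball s0 r. abscissa \<epsilon> ?B < Re s \<longrightarrow> g s = distance_zeta \<epsilon> ?B s"
    \<comment> \<open>The bound 1 keeps the shifted disk inside the half-plane where
      \<open>h\<close> is holomorphic, which reaches distance 1 to the left of the critical
      line.\<close>
    define r' where "r' = min r 1"
    define G where "G s = g (s + ?m) - h (s + ?m) - e s" for s
    have ball: "s + ?m \<in> ball s0 r" "D + real DIM('b) - 1 < Re (s + ?m)" if s: "s \<in> ball (s0 - ?m) r'" for s
    proof -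
      have n: "norm (s0 - (s + ?m)) < r'" using s by (simp add: dist_norm algebra_simps)
      then show "s + ?m \<in> ball s0 r" by (simp add: dist_norm r'_def)
      have "Re (s0 - (s + ?m)) < 1"
        using n complex_Re_le_cmod[of "s0 - (s + ?m)"] by (simp add: r'_def)
      then show "D + real DIM('b) - 1 < Re (s + ?m)" using s0 by (simp add: DB)
    qed
    have "G holomorphic_on ball (s0 - ?m) r'"
    proof -
      have "(g \<circ> (\<lambda>s. s + ?m)) holomorphic_on ball (s0 - ?m) r'"
        by (rule holomorphic_on_compose_gen[OF _ g]) (auto intro!: holomorphic_intros simp: ball simp del: mem_ball)
      moreover have "(h \<circ> (\<lambda>s. s + ?m)) holomorphic_on ball (s0 - ?m) r'"
        using ball(2) by (intro holomorphic_on_compose_gen[OF _ h(1)]) (auto intro!: holomorphic_intros)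
      moreover have "e holomorphic_on ball (s0 - ?m) r'" using e(1) by (rule holomorphic_on_subset) simp
      ultimately have "(\<lambda>s. (g \<circ> (\<lambda>s. s + ?m)) s - (h \<circ> (\<lambda>s. s + ?m)) s - e s) holomorphic_on ball (s0 - ?m) r'"
        by (intro holomorphic_intros)
      then show ?thesis by (simp add: G_def[abs_def])
    qed
    moreover have "G s = distance_zeta \<delta> A s" if s: "s \<in> ball (s0 - ?m) r'" "D < Re s" for s
      using ball(1)[OF s(1)] eq e(2)[OF s(2)] h(2)[of "s + ?m"] s(2) by (simp add: G_def DB)
    moreover have "0 < r'" using r by (simp add: r'_def)
    ultimately have "\<not> nonremovable_singularity \<delta> A (s0 - ?m)"
      unfolding nonremovable_singularity_def D_def by blast
    moreover have "Re (s0 - ?m) = abscissa \<delta> A" using s0 by (simp add: DB D_def)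
    ultimately show False using hyper by (simp add: maximally_hyperfractal_def)
  qed
  moreover have "bounded ?B" "?B \<noteq> {}" using A by (auto intro!: bounded_Times simp: box_ne_empty)
  ultimately show ?thesis by (simp add: maximally_hyperfractal_def)
qed

theorem theorem5p5:
  fixes A :: "(real ^ 'n) set" and \<delta> \<epsilon> :: real
  assumes "\<delta> > 0" and "\<epsilon> > 0"
    and "bounded A"
    and "maximally_hyperfractal \<delta> A"
  shows "maximally_hyperfractal \<epsilon> (A \<times> (cbox 0 1 :: (real ^ 'm) set))"
  \<comment> \<open>\<open>Cart_1\<close> turns the all-ones vector into \<open>One\<close>, the sum
    of the basis vectors.\<close>
  unfolding Cart_1 using assms(1,2,4) by (rule maximally_hyperfractal_Times_unit_cube)

end
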